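(* Let \[ G=P_4[\overline{K}_{1},\overline{K}_{16},\overline{K}_{8},\overline{K}_{36}] \qquad\text{and}\qquad H=\mathsf{Paw}[\overline{K}_{4},\overline{K}_{9},\overline{K}_{16},\overline{K}_{32}]. \] Then $G$ and $H$ have different numbers of edges, diameters, Wiener indices, and ranks of their distance matrices modulo $2$. More precisely, \[ |E(G)|=432,\quad \operatorname{diam}(G)=3,\quad W(G)=3264,\quad \operatorname{rank}_{\mathbb{F}_2}(D(G)\bmod 2)=2, \] \[ |E(H)|=372,\quad \operatorname{diam}(H)=2,\quad W(H)=3288,\quad \operatorname{rank}_{\mathbb{F}_2}(D(H)\bmod 2)=4. \] In particular, the rank of the distance matrix modulo $2$ is not determined by the real distance spectrum; that is, there exist two connected graphs with the same distance spectrum whose distance matrices reduced modulo $2$ have different ranks over $\mathbb{F}_2$ (namely $G$ and $H$).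
   Context: All graphs are finite, simple and undirected. For a connected graph $X$, the distance matrix is $D(X)=(d_X(u,v))_{u,v\in V(X)}$, where $d_X(u,v)$ is the distance between $u$ and $v$. The (real) distance spectrum of $X$ is the multiset of eigenvalues of $D(X)$ (with multiplicities). The Wiener index $W(X)$ is the sum of $d_X(u,v)$ over all unordered pairs $\{u,v\}$ of distinct vertices. $\operatorname{diam}(X)$ is the maximum distance between two vertices. $D(X)\bmod 2$ is the matrix over the two-element field $\mathbb{F}_2$ obtained by reducing the entries of $D(X)$ modulo $2$. For a connected graph $F$ with vertex set $\{0,1,\ldots,r-1\}$, $r\ge 2$, and positive integers $m_0,\ldots,m_{r-1}$, the independent-set blow-up $F[\overline{K}_{m_0},\ldots,\overline{K}_{m_{r-1}}]$ is the graph obtained by replacing each vertex $i$ with an independent set $V_i$ of size $m_i$ (the $V_i$ pairwise disjoint) and each edge $ij\in E(F)$ with all edges between $V_i$ and $V_j$ (and no other edges). $P_4$ is the path on vertices $0,1,2,3$ with edges $01,12,23$. $\mathsf{Paw}$ is the paw graph on vertices $0,1,2,3$ with edges $01,02,03,12$ (a triangle $0,1,2$ with a pendant vertex $3$ attached to $0$). *)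

theory Defs
  imports
    "Graph_Theory.Pair_Digraph"
    "Graph_Theory.Digraph_Component"
    "Jordan_Normal_Form.Char_Poly"
    "Jordan_Normal_Form.DL_Rank"
    "HOL-Library.Z2"
begin

text \<open>
  A finite simple undirected graph is a \<^locale>\<open>pair_graph\<close>: its arc relation is finite, symmetric
  and irreflexive, so an undirected edge \<open>uv\<close> is represented by the two arcs \<open>(u, v)\<close> and \<open>(v, u)\<close>.
\<close>

definition connected_graph :: "'a pair_pre_digraph \<Rightarrow> bool" where
  "connected_graph X \<longleftrightarrow> pair_graph X \<and> Digraph_Component.connected (with_proj X)"

definition edges :: "'a pair_pre_digraph \<Rightarrow> 'a set set" where
  "edges X = {{u, v} | u v. (u, v) \<in> parcs X}"

definition graph_dist :: "'a pair_pre_digraph \<Rightarrow> 'a \<Rightarrow> 'a \<Rightarrow> nat" where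
  "graph_dist X u v = (LEAST k. \<exists>p. pre_digraph.awalk (with_proj X) u p v \<and> length p = k)"

definition diam :: "'a pair_pre_digraph \<Rightarrow> nat" where
  "diam X = Max {graph_dist X u v | u v. u \<in> pverts X \<and> v \<in> pverts X}"

text \<open>
  The sum ranges over unordered pairs. In a graph the distance is symmetric, so the number
  selected by \<open>THE\<close> does not depend on how the pair is written.
\<close>

definition wiener_index :: "'a pair_pre_digraph \<Rightarrow> nat" where
  "wiener_index X =
     (\<Sum>e\<in>{{u, v} | u v. u \<in> pverts X \<and> v \<in> pverts X \<and> u \<noteq> v}.
        THE k. \<exists>u v. e = {u, v} \<and> u \<noteq> v \<and> k = graph_dist X u v)"

text \<open>
  Matrices are indexed by \<open>0, \<dots>, n - 1\<close>, so the distance matrix needs an enumeration of the vertices.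
  It is chosen arbitrarily: another choice conjugates the matrix by a permutation matrix, which
  changes neither the spectrum nor the rank.
\<close>

definition vertex_list :: "'a pair_pre_digraph \<Rightarrow> 'a list" where
  "vertex_list X = (SOME vs. distinct vs \<and> set vs = pverts X)"

definition distance_matrix :: "'a pair_pre_digraph \<Rightarrow> nat mat" where
  "distance_matrix X =
     mat (card (pverts X)) (card (pverts X))
       (\<lambda>(i, j). graph_dist X (vertex_list X ! i) (vertex_list X ! j))"

text \<open>
  The real distance matrix is symmetric, so its characteristic polynomial splits over the reals
  and the algebraic and geometric multiplicities of its eigenvalues agree.
\<close>

definition distance_spectrum :: "'a pair_pre_digraph \<Rightarrow> real multiset" where
  "distance_spectrum X = proots (char_poly (map_mat real (distance_matrix X)))"

text \<open>
  The type \<^typ>\<open>bit\<close> is the two-element field, and \<^const>\<open>of_nat\<close> into it is reduction modulo 2.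
\<close>

definition distance_matrix_mod2 :: "'a pair_pre_digraph \<Rightarrow> bit mat" where
  "distance_matrix_mod2 X = map_mat of_nat (distance_matrix X)"

definition distance_rank_mod2 :: "'a pair_pre_digraph \<Rightarrow> nat" where
  "distance_rank_mod2 X = vec_space.rank (card (pverts X)) (distance_matrix_mod2 X)"

text \<open>
  In the independent-set blow-up the vertex \<open>i\<close> of \<open>F\<close> is replaced by the vertices \<open>(i, k)\<close> with
  \<open>k < ms ! i\<close>. The definition is meant for \<open>F\<close> with vertex set \<open>{0..<length ms}\<close>.
\<close>

definition blow_up :: "nat pair_pre_digraph \<Rightarrow> nat list \<Rightarrow> (nat \<times> nat) pair_pre_digraph" where
  "blow_up F ms =
     \<lparr> pverts = {(i, k). i \<in> pverts F \<and> k < ms ! i},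
       parcs = {((i, k), (j, l)). (i, j) \<in> parcs F \<and> k < ms ! i \<and> l < ms ! j} \<rparr>"

definition P4 :: "nat pair_pre_digraph" where
  "P4 = \<lparr> pverts = {0, 1, 2, 3},
          parcs = (let E = {(0, 1), (1, 2), (2, 3)} in E \<union> E\<inverse>) \<rparr>"

definition Paw :: "nat pair_pre_digraph" where
  "Paw = \<lparr> pverts = {0, 1, 2, 3},
           parcs = (let E = {(0, 1), (0, 2), (0, 3), (1, 2)} in E \<union> E\<inverse>) \<rparr>"

end

theory Submission
  imports Defs
begin

text \<open>
  With \<open>Z\<close> the 0-1 matrix assigning the \<open>n\<close> vertices of a blow-up of \<open>F\<close> to its \<open>r\<close> parts,
  the distance matrix is \<open>Z (D(F) + 2 I) Z\<^sup>T - 2 I\<close>, however the vertices are ordered, and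
  \<open>Z\<^sup>T Z\<close> is the diagonal matrix \<open>M\<close> of the part sizes. By Sylvester's determinant identity its
  characteristic polynomial at \<open>x\<close> is \<open>(x + 2)\<^sup>n\<^sup>-\<^sup>r det ((x + 2) I - (D(F) + 2 I) M)\<close>,
  so cospectrality of the two graphs reduces to equality of two 4 by 4 determinants. Modulo 2 the
  distance matrix is \<open>Z D(F) Z\<^sup>T\<close>, whose rank is that of \<open>D(F)\<close> modulo 2.
\<close>

subsection \<open>Graph distance\<close>

text \<open>
  These local conditions characterise the graph distance of a connected graph, which reduces the
  distances of a concrete graph to a check over its arcs.
\<close>

definition is_distance :: "'a pair_pre_digraph \<Rightarrow> ('a \<Rightarrow> 'a \<Rightarrow> nat) \<Rightarrow> bool" where
  "is_distance X d \<longleftrightarrow> (\<forall>u\<in>pverts X. \<forall>v\<in>pverts X.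
     (d u v = 0 \<longleftrightarrow> u = v) \<and>
     (\<forall>w. (v, w) \<in> parcs X \<longrightarrow> d u w \<le> Suc (d u v)) \<and>
     (d u v \<noteq> 0 \<longrightarrow> (\<exists>w. (w, v) \<in> parcs X \<and> d u v = Suc (d u w))))"

lemma is_distance_eq_0_iff:
  "is_distance X d \<Longrightarrow> u \<in> pverts X \<Longrightarrow> v \<in> pverts X \<Longrightarrow> d u v = 0 \<longleftrightarrow> u = v"
  by (simp add: is_distance_def)

lemma is_distance_step:
  "is_distance X d \<Longrightarrow> u \<in> pverts X \<Longrightarrow> v \<in> pverts X \<Longrightarrow> (v, w) \<in> parcs X \<Longrightarrow> d u w \<le> Suc (d u v)"
  by (simp add: is_distance_def)

lemma is_distance_pred:
  assumes "is_distance X d" "u \<in> pverts X" "v \<in> pverts X" "u \<noteq> v"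
  obtains w where "(w, v) \<in> parcs X" "d u v = Suc (d u w)"
  using bspec[OF bspec[OF assms(1)[unfolded is_distance_def] assms(2)] assms(3)] assms(4) that
  by blast

text \<open>Quantifying over the arc set itself lets simplification decide the conditions on an
  explicitly listed finite set of arcs.\<close>

lemma is_distance_iff_Ball_parcs:
  "is_distance X d \<longleftrightarrow> (\<forall>u\<in>pverts X. \<forall>v\<in>pverts X.
     (d u v = 0 \<longleftrightarrow> u = v) \<and>
     (\<forall>e\<in>parcs X. fst e = v \<longrightarrow> d u (snd e) \<le> Suc (d u v)) \<and>
     (d u v \<noteq> 0 \<longrightarrow> (\<exists>e\<in>parcs X. snd e = v \<and> d u v = Suc (d u (fst e)))))"
proof -
  have "(\<forall>e\<in>parcs X. fst e = v \<longrightarrow> d u (snd e) \<le> Suc (d u v)) \<longleftrightarrow>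
      (\<forall>w. (v, w) \<in> parcs X \<longrightarrow> d u w \<le> Suc (d u v))" for u v
    by auto
  moreover have "(\<exists>e\<in>parcs X. snd e = v \<and> d u v = Suc (d u (fst e))) \<longleftrightarrow>
      (\<exists>w. (w, v) \<in> parcs X \<and> d u v = Suc (d u w))" for u v
    by force
  ultimately show ?thesis
    unfolding is_distance_def by simp
qed

context pair_wf_digraph
begin

text \<open>Along an arc \<open>d u\<close> rises by at most one. The start \<open>v\<close> varies
  in the induction, since removing the first arc moves it, while the base point \<open>u\<close>
  stays fixed.\<close>

lemma is_distance_le_awalk:
  assumes d: "is_distance G d" and u: "u \<in> pverts G" and p: "awalk v p w"
  shows "d u w \<le> d u v + length p"
  using p
proof (induction p arbitrary: v)
  case Nil
  then show ?case by (simp add: awalk_Nil_iff)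
next
  case (Cons e p)
  then have e: "e \<in> parcs G" "v = fst e" and p: "awalk (snd e) p w"
    by (auto simp: awalk_Cons_iff)
  from e have "d u (snd e) \<le> Suc (d u v)"
    using is_distance_step[OF d u, of v "snd e"] in_arcsD1[of v "snd e"] by simp
  with Cons.IH[OF p] show ?case by simp
qed

text \<open>Each predecessor lowers \<open>d u\<close> by one; tracing them back from
  \<open>v\<close> ends at the value 0, which only \<open>u\<close> has.\<close>

lemma is_distance_awalk:
  assumes d: "is_distance G d" and u: "u \<in> pverts G" and v: "v \<in> pverts G"
  shows "\<exists>p. awalk u p v \<and> length p = d u v"
  using v
proof (induction "d u v" arbitrary: v)
  case 0
  then have "u = v" using is_distance_eq_0_iff[OF d u] by simp
  then show ?case using 0 by (intro exI[of _ "[]"]) (auto simp: awalk_Nil_iff)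
next
  case (Suc n)
  then have "u \<noteq> v" using is_distance_eq_0_iff[OF d u] by (metis nat.simps(3))
  then obtain w where w: "(w, v) \<in> parcs G" "d u v = Suc (d u w)"
    using is_distance_pred[OF d u Suc.prems] by blast
  then obtain p where "awalk u p w" "length p = d u w"
    using Suc.hyps(1)[of w] Suc.hyps(2) in_arcsD1 by auto
  with w Suc.prems show ?case
    by (intro exI[of _ "p @ [(w, v)]"]) (auto simp: awalk_simps)
qed

lemma graph_dist_eqI:
  assumes d: "is_distance G d" and u: "u \<in> pverts G" and v: "v \<in> pverts G"
  shows "graph_dist G u v = d u v"
  unfolding graph_dist_def
proof (rule Least_equality)
  show "\<exists>p. awalk u p v \<and> length p = d u v"
    by (rule is_distance_awalk[OF assms])
next
  fix k assume "\<exists>p. awalk u p v \<and> length p = k"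
  then obtain p where "awalk u p v" "length p = k" by blast
  moreover have "d u u = 0" using is_distance_eq_0_iff[OF d u u] by simp
  ultimately show "d u v \<le> k" using is_distance_le_awalk[OF d u, of u p v] by simp
qed

end

text \<open>Any \<open>d\<close> satisfying the local conditions yields walks between all vertices.
  Connectedness is strong connectivity of the symmetrised digraph, to which reachability
  passes.\<close>

lemma connected_graphI:
  assumes "pair_graph X" and "pverts X \<noteq> {}" and d: "is_distance X d"
  shows "connected_graph X"
proof -
  interpret pair_graph X by fact
  have "strongly_connected (with_proj X)"
    unfolding strongly_connected_def
    using is_distance_awalk[OF d] assms(2) by (auto simp: reachable_awalk)
  then have "Digraph_Component.connected (with_proj X)"
    unfolding connected_def strongly_connected_def
    by (auto intro: reachable_mk_symmetricI)
  with assms(1) show ?thesis by (simp add: connected_graph_def)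
qed

section \<open>Counting over unordered pairs: edges and the Wiener index\<close>

lemma sum_unordered_pairs:
  fixes g :: "'a set \<Rightarrow> nat"
  assumes "finite A" and sym: "sym A" and irr: "irrefl A"
  shows "(\<Sum>(u, v)\<in>A. g {u, v}) = 2 * (\<Sum>e\<in>{{u, v} | u v. (u, v) \<in> A}. g e)"
proof -
  let ?E = "\<lambda>(u, v). {u, v}"
  have E: "{{u, v} | u v. (u, v) \<in> A} = ?E ` A" by (auto simp: image_iff)
  have "(\<Sum>(u, v)\<in>A. g {u, v}) = (\<Sum>e\<in>?E ` A. \<Sum>x | x \<in> A \<and> ?E x = e. g (?E x))"
    using sum.image_gen[OF \<open>finite A\<close>, of "\<lambda>x. g (?E x)" ?E] by (simp add: case_prod_unfold)
  also have "\<dots> = (\<Sum>e\<in>?E ` A. 2 * g e)"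
  proof (rule sum.cong[OF refl], clarify)
    fix u v assume uv: "(u, v) \<in> A"
    have "u \<noteq> v" using irr uv by (auto simp: irrefl_def)
    have vu: "(v, u) \<in> A" by (rule symD[OF sym uv])
    \<comment> \<open>The fibre over a pair consists of its two orientations, distinct by
      irreflexivity; hence the factor 2.\<close>
    have "{x. x \<in> A \<and> ?E x = {u, v}} = {(u, v), (v, u)}"
      using uv vu by (auto simp only: doubleton_eq_iff prod.case split: prod.splits)
    then show "(\<Sum>x | x \<in> A \<and> ?E x = {u, v}. g (?E x)) = 2 * g {u, v}"
      using \<open>u \<noteq> v\<close> by (simp add: insert_commute)
  qed
  finally show ?thesis by (simp add: E sum_distrib_left)
qed

lemma card_parcs:
  assumes "pair_graph X"
  shows "card (parcs X) = 2 * card (edges X)"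
proof -
  interpret pair_graph X by fact
  have "sym (parcs X)" by (auto intro: symI arcs_symmetric)
  moreover have "irrefl (parcs X)" using no_loops' by (auto simp: irrefl_def)
  ultimately show ?thesis
    using sum_unordered_pairs[of "parcs X" "\<lambda>_. 1"] pair_finite_arcs
    by (simp add: edges_def)
qed

text \<open>The double sum over ordered pairs can be evaluated part by part in a blow-up. Its
  diagonal vanishes and each unordered pair counts twice.\<close>

lemma sum_dist_eq_wiener_index:
  assumes fin: "finite (pverts X)"
    and d: "\<And>u v. u \<in> pverts X \<Longrightarrow> v \<in> pverts X \<Longrightarrow> graph_dist X u v = d u v"
    and sym: "\<And>u v. d u v = d v u" and zero: "\<And>u. d u u = 0"
  shows "(\<Sum>u\<in>pverts X. \<Sum>v\<in>pverts X. d u v) = 2 * wiener_index X"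
proof -
  let ?V = "pverts X" and ?A = "pverts X \<times> pverts X - Id"
  let ?g = "\<lambda>e. THE k. \<exists>u v. e = {u, v} \<and> u \<noteq> v \<and> k = graph_dist X u v"
  \<comment> \<open>The description is unique because writing the pair the other way gives the same
    number by symmetry of \<open>d\<close>.\<close>
  have g: "?g {u, v} = d u v" if "(u, v) \<in> ?A" for u v
  proof (rule the_equality)
    show "\<exists>x y. {u, v} = {x, y} \<and> x \<noteq> y \<and> d u v = graph_dist X x y"
      using that by (intro exI[of _ u] exI[of _ v]) (auto simp: d)
  next
    fix k assume "\<exists>x y. {u, v} = {x, y} \<and> x \<noteq> y \<and> k = graph_dist X x y"
    then show "k = d u v" using that d sym by (auto simp: doubleton_eq_iff)
  qed
  have "(\<Sum>u\<in>?V. \<Sum>v\<in>?V. d u v) = (\<Sum>(u, v)\<in>?V \<times> ?V. d u v)"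
    by (rule sum.cartesian_product)
  also have "\<dots> = (\<Sum>(u, v)\<in>?A. d u v)"
    using fin by (intro sum.mono_neutral_right) (auto simp: zero)
  also have "\<dots> = (\<Sum>(u, v)\<in>?A. ?g {u, v})"
  proof (rule sum.cong[OF refl])
    fix x assume "x \<in> ?A"
    then show "(case x of (u, v) \<Rightarrow> d u v) = (case x of (u, v) \<Rightarrow> ?g {u, v})"
      by (cases x) (simp only: prod.case g)
  qed
  also have "\<dots> = 2 * (\<Sum>e\<in>{{u, v} | u v. (u, v) \<in> ?A}. ?g e)"
    using fin by (intro sum_unordered_pairs) (auto simp: sym_def irrefl_def)
  also have "{{u, v} | u v. (u, v) \<in> ?A} = {{u, v} | u v. u \<in> ?V \<and> v \<in> ?V \<and> u \<noteq> v}"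
    by auto
  finally show ?thesis by (simp add: wiener_index_def)
qed

subsection \<open>Blow-ups\<close>

lemma pverts_blow_up: "pverts (blow_up F ms) = (SIGMA i:pverts F. {..<ms ! i})"
  by (auto simp: blow_up_def)

lemma mem_parcs_blow_up [simp]:
  "((i, k), (j, l)) \<in> parcs (blow_up F ms) \<longleftrightarrow> (i, j) \<in> parcs F \<and> k < ms ! i \<and> l < ms ! j"
  by (simp add: blow_up_def)

lemma pair_graph_blow_up:
  assumes "pair_graph F"
  shows "pair_graph (blow_up F ms)"
proof -
  interpret F: pair_graph F by fact
  have V: "finite (pverts (blow_up F ms))"
    using F.pair_finite_verts by (simp add: pverts_blow_up)
  have sub: "parcs (blow_up F ms) \<subseteq> pverts (blow_up F ms) \<times> pverts (blow_up F ms)"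
    using F.in_arcsD1 F.in_arcsD2 by (auto simp: pverts_blow_up)
  show ?thesis
  proof
    show "finite (parcs (blow_up F ms))"
      by (rule finite_subset[OF sub]) (use V in simp)
    show "symmetric (with_proj (blow_up F ms))"
      unfolding symmetric_def with_proj_simps
    proof (rule symI)
      fix u v assume "(u, v) \<in> parcs (blow_up F ms)"
      then show "(v, u) \<in> parcs (blow_up F ms)"
        by (cases u; cases v) (auto intro: F.arcs_symmetric)
    qed
    fix e assume e: "e \<in> parcs (blow_up F ms)"
    then show "fst e \<in> pverts (blow_up F ms)" "snd e \<in> pverts (blow_up F ms)"
      using sub by auto
    show "fst e \<noteq> snd e"
      using e by (cases e) (auto dest: F.no_loops')
  qed (rule V)
qed

definition blow_up_dist :: "(nat \<Rightarrow> nat \<Rightarrow> nat) \<Rightarrow> nat \<times> nat \<Rightarrow> nat \<times> nat \<Rightarrow> nat" where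
  "blow_up_dist d u v = (if u = v then 0 else if fst u = fst v then 2 else d (fst u) (fst v))"

text \<open>Copies of one vertex are joined by a walk of length 2 through a neighbour given by
  \<open>nb\<close>; \<open>pos\<close> supplies the copy \<open>(j', 0)\<close> of an intermediate
  vertex.\<close>

lemma is_distance_blow_up:
  assumes "pair_graph F" and d: "is_distance F d"
    and pos: "\<And>i. i \<in> pverts F \<Longrightarrow> 0 < ms ! i"
    and nb: "\<And>i. i \<in> pverts F \<Longrightarrow> \<exists>j. (i, j) \<in> parcs F"
  shows "is_distance (blow_up F ms) (blow_up_dist d)"
  unfolding is_distance_def
proof (intro ballI)
  interpret F: pair_graph F by fact
  note d0 = is_distance_eq_0_iff[OF d] and dS = is_distance_step[OF d]
  have d1: "d i j = Suc 0" if "(i, j) \<in> parcs F" for i j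
  proof -
    have "i \<in> pverts F" "j \<in> pverts F" "i \<noteq> j"
      using that F.in_arcsD1 F.in_arcsD2 F.no_loops' by auto
    with dS[of i i j] d0[of i i] d0[of i j] that show ?thesis by simp
  qed
  fix u v assume uv: "u \<in> pverts (blow_up F ms)" "v \<in> pverts (blow_up F ms)"
  obtain i k j l where u: "u = (i, k)" "i \<in> pverts F" "k < ms ! i"
    and v: "v = (j, l)" "j \<in> pverts F" "l < ms ! j"
    using uv by (cases u; cases v) (auto simp: pverts_blow_up)
  let ?d = "blow_up_dist d"
  have "?d u v = 0 \<longleftrightarrow> u = v"
    using u v d0 by (auto simp: blow_up_dist_def)
  moreover have "?d u w \<le> Suc (?d u v)" if w: "(v, w) \<in> parcs (blow_up F ms)" for w
  proof -
    obtain j' l' where w': "w = (j', l')" "(j, j') \<in> parcs F"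
      using w v by (cases w) auto
    then have "j \<noteq> j'" using F.no_loops' by blast
    \<comment> \<open>The delicate case is \<open>j' = i\<close>: returning to the part of
      \<open>u\<close> gives a value of at most 2, and \<open>d i j\<close> is positive because
      \<open>j \<noteq> j'\<close>.\<close>
    then show ?thesis
      using u v w' dS[of i j j'] d0[of i j] d1[of i j'] d1[of j j']
      by (auto simp: blow_up_dist_def)
  qed
  moreover have "\<exists>w. (w, v) \<in> parcs (blow_up F ms) \<and> ?d u v = Suc (?d u w)" if "?d u v \<noteq> 0"
  proof (cases "i = j")
    case True
    then obtain j' where j': "(i, j') \<in> parcs F" using nb u by blast
    then have "(j', i) \<in> parcs F" "j' \<in> pverts F" "i \<noteq> j'"
      using F.arcs_symmetric F.in_arcsD2 F.no_loops' by auto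
    \<comment> \<open>A copy of a neighbour of \<open>i\<close> is at distance 1 from
      \<open>u\<close> and adjacent to the twin \<open>v\<close>.\<close>
    then show ?thesis using True u v that pos d1 j'
      by (intro exI[of _ "(j', 0)"]) (auto simp: blow_up_dist_def)
  next
    case False
    then obtain j' where j': "(j', j) \<in> parcs F" "d i j = Suc (d i j')"
      using is_distance_pred[OF d] u v by metis
    then have "j' \<in> pverts F" using F.in_arcsD1 by auto
    show ?thesis
    proof (cases "j' = i")
      case True
      \<comment> \<open>The predecessor must be \<open>u\<close> itself: any other copy of
        \<open>i\<close> has distance 2, not 0, from \<open>u\<close>.\<close>
      then show ?thesis using u v j' False d0
        by (intro exI[of _ u]) (auto simp: blow_up_dist_def)
    next
      case False
      then show ?thesis using u v j' \<open>i \<noteq> j\<close> pos \<open>j' \<in> pverts F\<close>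
        by (intro exI[of _ "(j', 0)"]) (auto simp: blow_up_dist_def)
    qed
  qed
  ultimately show "(?d u v = 0 \<longleftrightarrow> u = v) \<and>
     (\<forall>w. (v, w) \<in> parcs (blow_up F ms) \<longrightarrow> ?d u w \<le> Suc (?d u v)) \<and>
     (?d u v \<noteq> 0 \<longrightarrow> (\<exists>w. (w, v) \<in> parcs (blow_up F ms) \<and> ?d u v = Suc (?d u w)))"
    by blast
qed

lemma card_edges_blow_up:
  assumes "pair_graph F"
  shows "2 * card (edges (blow_up F ms)) = (\<Sum>(i, j)\<in>parcs F. ms ! i * ms ! j)"
proof -
  interpret F: pair_graph F by fact
  let ?S = "SIGMA x:parcs F. {..<ms ! fst x} \<times> {..<ms ! snd x}"
  \<comment> \<open>An arc of the blow-up is an arc of \<open>F\<close> together with a copy of each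
    end; the map regroups the coordinates.\<close>
  have "bij_betw (\<lambda>((i, j), (k, l)). ((i, k), (j, l))) ?S (parcs (blow_up F ms))"
    by (rule bij_betw_byWitness[where f' = "\<lambda>((i, k), (j, l)). ((i, j), (k, l))"]) auto
  then have "card (parcs (blow_up F ms)) = card ?S"
    by (simp add: bij_betw_same_card)
  also have "\<dots> = (\<Sum>(i, j)\<in>parcs F. ms ! i * ms ! j)"
    using F.pair_finite_arcs by (simp add: card_SigmaI case_prod_unfold)
  finally show ?thesis using card_parcs[OF pair_graph_blow_up[OF assms]] by simp
qed

lemma sum_pverts_blow_up:
  fixes f :: "nat \<Rightarrow> nat"
  assumes "finite (pverts F)"
  shows "(\<Sum>v\<in>pverts (blow_up F ms). f (fst v)) = (\<Sum>i\<in>pverts F. ms ! i * f i)"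
proof -
  have "(\<Sum>v\<in>pverts (blow_up F ms). f (fst v)) = (\<Sum>i\<in>pverts F. \<Sum>k<ms ! i. f i)"
    using assms sum.Sigma[of "pverts F" "\<lambda>i. {..<ms ! i}" "\<lambda>i k. f i"]
    by (simp add: pverts_blow_up case_prod_unfold)
  then show ?thesis by simp
qed

subsection \<open>Block matrices\<close>

text \<open>
  Block column and row operations on \<open>[[y I, A], [B, I]]\<close> give two triangular forms.
\<close>

lemma det_sylvester:
  fixes A :: "'a :: idom mat"
  assumes A: "A \<in> carrier_mat n r" and B: "B \<in> carrier_mat r n"
  shows "y ^ r * det (y \<cdot>\<^sub>m 1\<^sub>m n - A * B) = y ^ n * det (y \<cdot>\<^sub>m 1\<^sub>m r - B * A)"
proof -
  let ?P = "four_block_mat (y \<cdot>\<^sub>m 1\<^sub>m n) A B (1\<^sub>m r)"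
  let ?L = "four_block_mat (1\<^sub>m n) (0\<^sub>m n r) (- B) (y \<cdot>\<^sub>m 1\<^sub>m r)"
  let ?R = "four_block_mat (1\<^sub>m n) (0\<^sub>m n r) (- B) (1\<^sub>m r)"
  have P: "?P \<in> carrier_mat (n + r) (n + r)" by simp
  have L: "?L \<in> carrier_mat (n + r) (n + r)" by simp
  have R: "?R \<in> carrier_mat (n + r) (n + r)" by simp
  have "?P * ?R = four_block_mat (y \<cdot>\<^sub>m 1\<^sub>m n - A * B) A (0\<^sub>m r n) (1\<^sub>m r)"
    using A B by (subst mult_four_block_mat[OF _ A B _ _ _ _ one_carrier_mat]) 
      (auto intro!: cong_four_block_mat)
  then have "det ?P * det ?R = det (y \<cdot>\<^sub>m 1\<^sub>m n - A * B)"
    using A B by (subst det_mult[OF P R, symmetric])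
      (simp add: det_four_block_mat_lower_left_zero[OF minus_carrier_mat[OF mult_carrier_mat[OF A B]] A refl])
  moreover have "det ?R = 1"
    using B by (subst det_four_block_mat_upper_right_zero[of _ n _ r]) auto
  moreover have "?L * ?P = four_block_mat (y \<cdot>\<^sub>m 1\<^sub>m n) A (0\<^sub>m r n) (y \<cdot>\<^sub>m 1\<^sub>m r - B * A)"
    using A B by (subst mult_four_block_mat[OF _ _ _ _ _ A B one_carrier_mat])
      (auto intro!: cong_four_block_mat)
  then have "det ?L * det ?P = y ^ n * det (y \<cdot>\<^sub>m 1\<^sub>m r - B * A)"
    using A B by (subst det_mult[OF L P, symmetric])
      (simp add: det_four_block_mat_lower_left_zero
        [OF smult_carrier_mat[OF one_carrier_mat] A refl minus_carrier_mat[OF mult_carrier_mat[OF B A]]] det_smult)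
  moreover have "det ?L = y ^ r"
    using B by (subst det_four_block_mat_upper_right_zero[of _ n _ r]) (auto simp: det_smult)
  ultimately show ?thesis by (metis mult.right_neutral)
qed

text \<open>With \<open>A\<close> the part indicator and \<open>B\<close> the matrix
  \<open>c\<close> with columns repeated along \<open>p\<close>, the given matrix is
  \<open>A * B - t I\<close>, so its characteristic matrix is \<open>(x + t) I - A * B\<close>.
  Sylvester's identity at \<open>y = [:t, 1:]\<close> passes to \<open>B * A\<close>, which is
  \<open>c\<close> times the diagonal matrix of part sizes. Powers on both sides avoid
  division.\<close>

lemma char_poly_block_mat:
  fixes c :: "nat \<Rightarrow> nat \<Rightarrow> 'a :: idom"
  assumes p: "\<And>i. i < n \<Longrightarrow> p i < r"
  shows "[:t, 1:] ^ r * char_poly (mat n n (\<lambda>(i, j). c (p i) (p j) - (if i = j then t else 0))) =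
    [:t, 1:] ^ n * det (mat r r (\<lambda>(a, b). (if a = b then [:t, 1:] else 0)
                                    - [:c a b * of_nat (card {i. i < n \<and> p i = b}):]))"
proof -
  let ?A = "mat n r (\<lambda>(i, a). if p i = a then 1 else 0) :: 'a poly mat"
  let ?B = "mat r n (\<lambda>(a, j). [:c a (p j):])"
  have A: "?A \<in> carrier_mat n r" and B: "?B \<in> carrier_mat r n" by simp_all
  have "char_poly_matrix (mat n n (\<lambda>(i, j). c (p i) (p j) - (if i = j then t else 0))) =
      [:t, 1:] \<cdot>\<^sub>m 1\<^sub>m n - ?A * ?B"
  proof (intro eq_matI)
    fix i j assume "i < dim_row ([:t, 1:] \<cdot>\<^sub>m 1\<^sub>m n - ?A * ?B)" "j < dim_col ([:t, 1:] \<cdot>\<^sub>m 1\<^sub>m n - ?A * ?B)"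
    then have ij: "i < n" "j < n" by simp_all
    have "(?A * ?B) $$ (i, j) = (\<Sum>a = 0..<r. (if p i = a then 1 else 0) * [:c a (p j):])"
      using ij by (simp add: scalar_prod_def)
    \<comment> \<open>Only \<open>a = p i\<close> survives, and it lies in the summation range
      because \<open>p i < r\<close>.\<close>
    also have "\<dots> = (\<Sum>a\<in>{p i}. [:c a (p j):])"
      using p ij by (intro sum.mono_neutral_cong_right) auto
    finally show "char_poly_matrix (mat n n (\<lambda>(i, j). c (p i) (p j) - (if i = j then t else 0))) $$ (i, j) =
        ([:t, 1:] \<cdot>\<^sub>m 1\<^sub>m n - ?A * ?B) $$ (i, j)"
      using ij by (simp add: char_poly_matrix_def)
  qed (auto simp: char_poly_matrix_def)
  moreover have "[:t, 1:] \<cdot>\<^sub>m 1\<^sub>m r - ?B * ?A = mat r r (\<lambda>(a, b). (if a = b then [:t, 1:] else 0)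
      - [:c a b * of_nat (card {i. i < n \<and> p i = b}):])"
  proof (intro eq_matI)
    fix a b assume "a < dim_row (mat r r (\<lambda>(a, b). (if a = b then [:t, 1:] else 0)
      - [:c a b * of_nat (card {i. i < n \<and> p i = b}):]))"
     and "b < dim_col (mat r r (\<lambda>(a, b). (if a = b then [:t, 1:] else 0)
      - [:c a b * of_nat (card {i. i < n \<and> p i = b}):]))"
    then have ab: "a < r" "b < r" by simp_all
    have "(?B * ?A) $$ (a, b) = (\<Sum>i = 0..<n. [:c a (p i):] * (if p i = b then 1 else 0))"
      using ab by (simp add: scalar_prod_def)
    also have "\<dots> = (\<Sum>i | i < n \<and> p i = b. [:c a b:])"
      by (intro sum.mono_neutral_cong_right) auto
    also have "\<dots> = [:c a b * of_nat (card {i. i < n \<and> p i = b}):]"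
      by (simp add: of_nat_poly mult.commute)
    finally show "([:t, 1:] \<cdot>\<^sub>m 1\<^sub>m r - ?B * ?A) $$ (a, b) =
      mat r r (\<lambda>(a, b). (if a = b then [:t, 1:] else 0)
      - [:c a b * of_nat (card {i. i < n \<and> p i = b}):]) $$ (a, b)"
      using ab by auto
  qed auto
  ultimately show ?thesis
    using det_sylvester[OF A B, of "[:t, 1:]"] by (simp add: char_poly_def)
qed

text \<open>By \<open>rep\<close> every column equals one belonging to \<open>U\<close>. A linear
  relation among these holds at every \<open>a\<close> in \<open>R\<close>, because \<open>p\<close>
  is onto \<open>R\<close>, so \<open>indep\<close> applies.\<close>

lemma rank_block_mat:
  fixes k :: "nat \<Rightarrow> nat \<Rightarrow> 'a :: field"
  assumes p: "p ` {..<n} = R" and U: "U \<subseteq> R"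
    and rep: "\<And>b. b \<in> R \<Longrightarrow> \<exists>b'\<in>U. \<forall>a\<in>R. k a b = k a b'"
    and indep: "\<And>f. (\<And>a. a \<in> R \<Longrightarrow> (\<Sum>b\<in>U. f b * k a b) = 0) \<Longrightarrow> \<forall>b\<in>U. f b = 0"
  shows "vec_space.rank n (mat n n (\<lambda>(i, j). k (p i) (p j))) = card U"
proof -
  interpret vec_space "TYPE('a)" n .
  let ?M = "mat n n (\<lambda>(i, j). k (p i) (p j))"
  \<comment> \<open>\<open>w b\<close> is the column of \<open>?M\<close> at any index
    \<open>j\<close> with \<open>p j = b\<close>.\<close>
  define w where "w b = vec n (\<lambda>i. k (p i) b)" for b
  have M: "?M \<in> carrier_mat n n" by simp
  have finR: "finite R" using p by auto
  have finU: "finite U" using finR U by (rule rev_finite_subset)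
  have pR: "p i \<in> R" if "i < n" for i using p that by auto
  have "set (cols ?M) = w ` R"
    using p by (auto simp: cols_def w_def image_image intro!: image_eqI eq_vecI)
  also have "\<dots> = w ` U"
  proof
    show "w ` R \<subseteq> w ` U"
    proof clarify
      fix b assume "b \<in> R"
      from rep[OF this] obtain b' where b': "b' \<in> U" "\<forall>a\<in>R. k a b = k a b'" by blast
      then have "w b = w b'" using pR by (auto simp: w_def)
      with b' show "w b \<in> w ` U" by blast
    qed
  qed (use U in blast)
  finally have cols: "set (cols ?M) = w ` U" .
  have inj: "inj_on w U"
  proof (rule inj_onI, rule ccontr)
    fix b b' assume b: "b \<in> U" "b' \<in> U" "w b = w b'" "b \<noteq> b'"
    \<comment> \<open>Equal columns for \<open>b \<noteq> b'\<close> would satisfy this nontrivial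
      relation. Injectivity ensures that \<open>U\<close> yields \<open>card U\<close> different
      columns.\<close>
    let ?f = "\<lambda>x. if x = b then 1 else if x = b' then - 1 else 0 :: 'a"
    have "(\<Sum>x\<in>U. ?f x * k a x) = 0" if "a \<in> R" for a
    proof -
      obtain i where i: "i < n" "p i = a" using p \<open>a \<in> R\<close> by auto
      have "w b $ i = w b' $ i" using b by simp
      then have "k a b = k a b'" using i by (simp add: w_def)
      have "(\<Sum>x\<in>U. ?f x * k a x) = (\<Sum>x\<in>{b, b'}. ?f x * k a x)"
        using finU b by (intro sum.mono_neutral_right) auto
      then show ?thesis using b \<open>k a b = k a b'\<close> by simp
    qed
    then have "\<forall>x\<in>U. ?f x = 0" by (rule indep)
    with b show False by auto
  qed
  have "lin_indpt (w ` U)"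
  proof (rule finite_lin_indpt2)
    show "finite (w ` U)" using finU by simp
    show carr: "w ` U \<subseteq> carrier_vec n" by (auto simp: w_def)
    fix f assume f: "lincomb f (w ` U) = 0\<^sub>v n"
    have "(\<Sum>b\<in>U. f (w b) * k a b) = 0" if "a \<in> R" for a
    proof -
      obtain i where i: "i < n" "p i = a" using p \<open>a \<in> R\<close> by auto
      have "0 = lincomb f (w ` U) $ i" using f i by simp
      also have "\<dots> = (\<Sum>v\<in>w ` U. f v * v $ i)"
        by (rule lincomb_index[OF i(1) carr])
      also have "\<dots> = (\<Sum>b\<in>U. f (w b) * w b $ i)"
        using inj by (simp add: sum.reindex)
      finally show ?thesis using i by (simp add: w_def)
    qed
    from indep[OF this] show "\<forall>v\<in>w ` U. f v = 0" by blast
  qed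
  \<comment> \<open>The independent set contains all columns, so it is maximal and its size is the
    rank.\<close>
  then have "maximal (w ` U) (\<lambda>T. T \<subseteq> set (cols ?M) \<and> lin_indpt T)"
    by (auto simp: maximal_def cols)
  from rank_card_indpt[OF M this] show ?thesis
    using inj by (simp add: card_image)
qed

subsection \<open>Distance matrices of blow-ups\<close>

text \<open>The parameter \<open>d\<close> lets an explicit formula stand for the distance of
  \<open>F\<close>; \<open>neighbour\<close> provides the walks of length 2 between copies of a
  vertex.\<close>

locale blow_up_graph =
  fixes F :: "nat pair_pre_digraph" and ms :: "nat list" and d :: "nat \<Rightarrow> nat \<Rightarrow> nat"
  assumes graph: "pair_graph F"
    and nonempty: "pverts F \<noteq> {}"
    and dist: "is_distance F d"
    and dist_sym: "d i j = d j i"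
    and pos: "i \<in> pverts F \<Longrightarrow> 0 < ms ! i"
    and neighbour: "i \<in> pverts F \<Longrightarrow> \<exists>j. (i, j) \<in> parcs F"
begin

text \<open>
  Distinct vertices of the same part are at distance 2 because they share a neighbour. The matrix of
  \<open>twin_dist\<close> is \<open>D(F) + 2 I\<close>.
\<close>

definition twin_dist :: "nat \<Rightarrow> nat \<Rightarrow> nat" where
  "twin_dist i j = (if i = j then 2 else d i j)"

lemma finite_verts: "finite (pverts F)"
  using graph by (simp add: pair_graph_def pair_digraph_def pair_fin_digraph_def pair_fin_digraph_axioms_def)

lemma finite_pverts: "finite (pverts (blow_up F ms))"
  using finite_verts by (simp add: pverts_blow_up)

lemma graph_dist:
  assumes "u \<in> pverts (blow_up F ms)" "v \<in> pverts (blow_up F ms)"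
  shows "graph_dist (blow_up F ms) u v = blow_up_dist d u v"
proof -
  interpret pair_graph "blow_up F ms" by (rule pair_graph_blow_up[OF graph])
  show ?thesis
    by (rule graph_dist_eqI[OF is_distance_blow_up[OF graph dist pos neighbour] assms])
qed

lemma connected_graph: "connected_graph (blow_up F ms)"
proof (rule connected_graphI[OF pair_graph_blow_up[OF graph] _
        is_distance_blow_up[OF graph dist pos neighbour]])
  show "pverts (blow_up F ms) \<noteq> {}"
    using nonempty pos by (fastforce simp: pverts_blow_up)
qed

lemma card_pverts: "card (pverts (blow_up F ms)) = (\<Sum>i\<in>pverts F. ms ! i)"
  using finite_verts by (simp add: pverts_blow_up)

text \<open>\<open>twin_dist\<close> depends on the parts alone, so its sum reduces to one over
  \<open>F\<close>. It exceeds the distance by 2 exactly on the diagonal; this correction stands on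
  the left to avoid subtraction on \<open>nat\<close>.\<close>

lemma wiener_index:
  "2 * wiener_index (blow_up F ms) + 2 * (\<Sum>i\<in>pverts F. ms ! i) =
    (\<Sum>i\<in>pverts F. ms ! i * (\<Sum>j\<in>pverts F. ms ! j * twin_dist i j))"
proof -
  let ?V = "pverts (blow_up F ms)"
  have "(\<Sum>u\<in>?V. \<Sum>v\<in>?V. blow_up_dist d u v) = 2 * wiener_index (blow_up F ms)"
    by (rule sum_dist_eq_wiener_index[OF finite_pverts graph_dist])
      (auto simp: blow_up_dist_def dist_sym)
  moreover have "(\<Sum>v\<in>?V. blow_up_dist d u v) + 2 = (\<Sum>v\<in>?V. twin_dist (fst u) (fst v))"
    if "u \<in> ?V" for u
  proof -
    have "(\<Sum>v\<in>?V. twin_dist (fst u) (fst v)) = (\<Sum>v\<in>?V. blow_up_dist d u v + (if v = u then 2 else 0))"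
      by (intro sum.cong) (auto simp: blow_up_dist_def twin_dist_def)
    then show ?thesis using that finite_pverts by (simp add: sum.distrib)
  qed
  then have "(\<Sum>u\<in>?V. (\<Sum>v\<in>?V. blow_up_dist d u v) + 2) = (\<Sum>u\<in>?V. \<Sum>v\<in>?V. twin_dist (fst u) (fst v))"
    by (intro sum.cong) auto
  moreover have "(\<Sum>u\<in>?V. \<Sum>v\<in>?V. twin_dist (fst u) (fst v)) =
      (\<Sum>i\<in>pverts F. ms ! i * (\<Sum>j\<in>pverts F. ms ! j * twin_dist i j))"
    by (simp add: sum_pverts_blow_up finite_verts
        sum_pverts_blow_up[of F "\<lambda>i. \<Sum>j\<in>pverts F. ms ! j * twin_dist i j"])
  ultimately show ?thesis
    by (simp only: sum.distrib sum_constant card_pverts) (simp add: mult.commute)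
qed

text \<open>Bounding \<open>twin_dist\<close> also covers pairs inside one part, at distance 2. The
  value \<open>k\<close> is attained at the copies with index 0, which exist by
  \<open>pos\<close>.\<close>

lemma diam_eqI:
  assumes le: "\<And>i j. i \<in> pverts F \<Longrightarrow> j \<in> pverts F \<Longrightarrow> twin_dist i j \<le> k"
    and ij: "i \<in> pverts F" "j \<in> pverts F" "i \<noteq> j" "d i j = k"
  shows "diam (blow_up F ms) = k"
  unfolding diam_def
proof (rule Max_eqI)
  let ?V = "pverts (blow_up F ms)"
  have "{graph_dist (blow_up F ms) u v | u v. u \<in> ?V \<and> v \<in> ?V} =
      (\<lambda>(u, v). graph_dist (blow_up F ms) u v) ` (?V \<times> ?V)"
    by auto
  then show "finite {graph_dist (blow_up F ms) u v | u v. u \<in> ?V \<and> v \<in> ?V}"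
    using finite_pverts by simp
  fix x assume "x \<in> {graph_dist (blow_up F ms) u v | u v. u \<in> ?V \<and> v \<in> ?V}"
  then obtain u v where "u \<in> ?V" "v \<in> ?V" "x = blow_up_dist d u v"
    using graph_dist by auto
  then show "x \<le> k"
    using le[of "fst u" "fst v"] by (auto simp: pverts_blow_up blow_up_dist_def twin_dist_def)
next
  have "(i, 0) \<in> pverts (blow_up F ms)" "(j, 0) \<in> pverts (blow_up F ms)"
    using ij pos by (auto simp: pverts_blow_up)
  moreover from this have "graph_dist (blow_up F ms) (i, 0) (j, 0) = k"
    using ij by (simp add: graph_dist blow_up_dist_def)
  ultimately show "k \<in> {graph_dist (blow_up F ms) u v | u v.
      u \<in> pverts (blow_up F ms) \<and> v \<in> pverts (blow_up F ms)}"
    by blast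
qed

section \<open>The distance matrix in the chosen vertex order\<close>

definition part_of :: "nat \<Rightarrow> nat" where
  "part_of i = fst (vertex_list (blow_up F ms) ! i)"

lemma vertex_list:
  "distinct (vertex_list (blow_up F ms))" "set (vertex_list (blow_up F ms)) = pverts (blow_up F ms)"
proof -
  have "\<exists>vs. distinct vs \<and> set vs = pverts (blow_up F ms)"
    using finite_distinct_list[OF finite_pverts] by blast
  from someI_ex[OF this] show "distinct (vertex_list (blow_up F ms))"
    "set (vertex_list (blow_up F ms)) = pverts (blow_up F ms)"
    by (simp_all add: vertex_list_def)
qed

lemma bij_betw_vertex_list:
  "bij_betw ((!) (vertex_list (blow_up F ms))) {..<card (pverts (blow_up F ms))} (pverts (blow_up F ms))"
  using vertex_list by (intro bij_betw_nth) (auto simp: distinct_card[symmetric])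

text \<open>No part is empty, so every vertex of \<open>F\<close> is hit. \<open>part_of\<close>
  serves as the map \<open>p\<close> of the block matrix lemmas.\<close>

lemma part_of_image: "part_of ` {..<card (pverts (blow_up F ms))} = pverts F"
proof -
  have "part_of ` {..<card (pverts (blow_up F ms))} = fst ` pverts (blow_up F ms)"
    using bij_betw_imp_surj_on[OF bij_betw_vertex_list]
    unfolding part_of_def by (metis image_image)
  also have "\<dots> = pverts F"
    using pos by (force simp: pverts_blow_up)
  finally show ?thesis .
qed

lemma card_part:
  assumes "b \<in> pverts F"
  shows "card {i. i < card (pverts (blow_up F ms)) \<and> part_of i = b} = ms ! b"
proof -
  let ?I = "{i. i < card (pverts (blow_up F ms)) \<and> part_of i = b}"
  have "(!) (vertex_list (blow_up F ms)) ` ?I = {v \<in> (!) (vertex_list (blow_up F ms)) `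
      {..<card (pverts (blow_up F ms))}. fst v = b}"
    by (auto simp: part_of_def)
  then have "(!) (vertex_list (blow_up F ms)) ` ?I = {v \<in> pverts (blow_up F ms). fst v = b}"
    unfolding bij_betw_imp_surj_on[OF bij_betw_vertex_list] .
  moreover have "inj_on ((!) (vertex_list (blow_up F ms))) ?I"
    by (rule inj_on_subset[OF bij_betw_imp_inj_on[OF bij_betw_vertex_list]]) auto
  ultimately have "card ?I = card {v \<in> pverts (blow_up F ms). fst v = b}"
    using card_image by fastforce
  also have "{v \<in> pverts (blow_up F ms). fst v = b} = {b} \<times> {..<ms ! b}"
    using assms by (auto simp: pverts_blow_up)
  finally show ?thesis by simp
qed

text \<open>The truncated subtraction is exact: on the diagonal \<open>twin_dist\<close> is 2, and
  elsewhere 0 is subtracted.\<close>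

lemma distance_matrix:
  defines "n \<equiv> card (pverts (blow_up F ms))"
  shows "distance_matrix (blow_up F ms) =
    mat n n (\<lambda>(i, j). twin_dist (part_of i) (part_of j) - (if i = j then 2 else 0))"
proof -
  let ?v = "(!) (vertex_list (blow_up F ms))"
  have "graph_dist (blow_up F ms) (?v i) (?v j) =
      twin_dist (part_of i) (part_of j) - (if i = j then 2 else 0)"
    if "i < n" "j < n" for i j
  proof -
    have "?v i \<in> pverts (blow_up F ms)" "?v j \<in> pverts (blow_up F ms)"
      using bij_betwE[OF bij_betw_vertex_list] that by (auto simp: n_def)
    moreover have "?v i = ?v j \<longleftrightarrow> i = j"
      using inj_onD[OF bij_betw_imp_inj_on[OF bij_betw_vertex_list], of i j] that
      by (auto simp: n_def)
    ultimately show ?thesis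
      by (simp add: graph_dist blow_up_dist_def twin_dist_def part_of_def)
  qed
  then show ?thesis
    unfolding distance_matrix_def n_def[symmetric] by (intro cong_mat) auto
qed

text \<open>This is \<open>char_poly_block_mat\<close> with \<open>p = part_of\<close>,
  \<open>t = 2\<close> and \<open>c = twin_dist\<close>; \<open>card_part\<close> identifies the
  part sizes with the entries of \<open>ms\<close>.\<close>

lemma char_poly_distance_matrix:
  assumes "pverts F = {..<r}"
  shows "[:2, 1:] ^ r * char_poly (map_mat real (distance_matrix (blow_up F ms))) =
    [:2, 1:] ^ (\<Sum>i\<in>pverts F. ms ! i) *
    det (mat r r (\<lambda>(a, b). (if a = b then [:2, 1:] else 0) - [:real (twin_dist a b) * real (ms ! b):]))"
proof -
  let ?n = "card (pverts (blow_up F ms))"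
  have "map_mat real (distance_matrix (blow_up F ms)) =
      mat ?n ?n (\<lambda>(i, j). real (twin_dist (part_of i) (part_of j)) - (if i = j then 2 else 0))"
    by (intro eq_matI) (auto simp: distance_matrix twin_dist_def)
  moreover have "part_of i < r" if "i < ?n" for i
    using part_of_image assms that by auto
  moreover have "mat r r (\<lambda>(a, b). (if a = b then [:2, 1:] else 0)
        - [:real (twin_dist a b) * real (card {i. i < ?n \<and> part_of i = b}):]) =
      mat r r (\<lambda>(a, b). (if a = b then [:2, 1:] else 0) - [:real (twin_dist a b) * real (ms ! b):])"
    by (intro eq_matI) (auto simp: card_part assms)
  ultimately show ?thesis
    using char_poly_block_mat[of ?n part_of r 2 "\<lambda>a b. real (twin_dist a b)"]
    by (simp add: card_pverts)
qed

text \<open>The diagonal correction 2 vanishes in \<open>bit\<close>, so the entries depend on the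
  parts alone and \<open>rank_block_mat\<close> applies.\<close>

lemma distance_rank_mod2:
  assumes "U \<subseteq> pverts F"
    and "\<And>b. b \<in> pverts F \<Longrightarrow> \<exists>b'\<in>U. \<forall>a\<in>pverts F. (of_nat (twin_dist a b) :: bit) = of_nat (twin_dist a b')"
    and "\<And>f. (\<And>a. a \<in> pverts F \<Longrightarrow> (\<Sum>b\<in>U. f b * (of_nat (twin_dist a b) :: bit)) = 0) \<Longrightarrow> \<forall>b\<in>U. f b = 0"
  shows "distance_rank_mod2 (blow_up F ms) = card U"
proof -
  let ?n = "card (pverts (blow_up F ms))"
  have "distance_matrix_mod2 (blow_up F ms) =
      mat ?n ?n (\<lambda>(i, j). of_nat (twin_dist (part_of i) (part_of j)))"
    unfolding distance_matrix_mod2_def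
    by (intro eq_matI) (auto simp: distance_matrix twin_dist_def)
  then show ?thesis
    using rank_block_mat[OF part_of_image assms] by (simp add: distance_rank_mod2_def)
qed

end

subsection \<open>The two graphs\<close>

lemma pverts_P4: "pverts P4 = {..<4}" by (auto simp: P4_def)
lemma pverts_Paw: "pverts Paw = {..<4}" by (auto simp: Paw_def)
lemma parcs_P4: "parcs P4 = {(0, 1), (1, 2), (2, 3), (1, 0), (2, 1), (3, 2)}"
  by (auto simp: P4_def)
lemma parcs_Paw: "parcs Paw = {(0, 1), (0, 2), (0, 3), (1, 2), (1, 0), (2, 0), (3, 0), (2, 1)}"
  by (auto simp: Paw_def)

text \<open>This is \<open>|i - j|\<close>, written with truncated subtraction.\<close>

definition dist_P4 :: "nat \<Rightarrow> nat \<Rightarrow> nat" where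
  "dist_P4 i j = (i - j) + (j - i)"

text \<open>Among pairs of distinct vertices avoiding 0, the sum 3 singles out the edge 12; the
  pairs 13 and 23 are joined only through 0.\<close>

definition dist_Paw :: "nat \<Rightarrow> nat \<Rightarrow> nat" where
  "dist_Paw i j = (if i = j then 0 else if i = 0 \<or> j = 0 \<or> i + j = 3 then 1 else 2)"

lemma lessThan_4: "{..<4} = {0, 1, 2, 3 :: nat}" by auto

lemma sum_lessThan_4:
  fixes g :: "nat \<Rightarrow> 'a :: comm_monoid_add"
  shows "(\<Sum>i<4. g i) = g 0 + g 1 + g 2 + g 3"
  by (simp add: lessThan_4 add.assoc)

lemma pair_graph_P4: "pair_graph P4"
proof
  show "symmetric (with_proj P4)"
    by (simp only: symmetric_def with_proj_simps P4_def pair_pre_digraph.select_convs Let_def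
        sym_Un_converse)
qed (auto simp: pverts_P4 parcs_P4)

lemma pair_graph_Paw: "pair_graph Paw"
proof
  show "symmetric (with_proj Paw)"
    by (simp only: symmetric_def with_proj_simps Paw_def pair_pre_digraph.select_convs Let_def
        sym_Un_converse)
qed (auto simp: pverts_Paw parcs_Paw)

interpretation G: blow_up_graph P4 "[1, 16, 8, 36]" dist_P4
proof (rule blow_up_graph.intro[OF pair_graph_P4])
  show "is_distance P4 dist_P4"
    by (simp add: is_distance_iff_Ball_parcs pverts_P4 parcs_P4 dist_P4_def lessThan_4)
qed (auto simp: pverts_P4 parcs_P4 dist_P4_def lessThan_4)

interpretation H: blow_up_graph Paw "[4, 9, 16, 32]" dist_Paw
proof (rule blow_up_graph.intro[OF pair_graph_Paw])
  show "is_distance Paw dist_Paw"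
    by (simp add: is_distance_iff_Ball_parcs pverts_Paw parcs_Paw dist_Paw_def lessThan_4)
qed (auto simp: pverts_Paw parcs_Paw dist_Paw_def lessThan_4)

lemma card_edges:
  "card (edges (blow_up P4 [1, 16, 8, 36])) = 432"
  "card (edges (blow_up Paw [4, 9, 16, 32])) = 372"
  using card_edges_blow_up[OF G.graph, of "[1, 16, 8, 36]"] card_edges_blow_up[OF H.graph, of "[4, 9, 16, 32]"]
  by (simp_all add: parcs_P4 parcs_Paw)

lemma wiener_indices:
  "wiener_index (blow_up P4 [1, 16, 8, 36]) = 3264"
  "wiener_index (blow_up Paw [4, 9, 16, 32]) = 3288"
  using G.wiener_index H.wiener_index
  by (simp_all add: pverts_P4 pverts_Paw lessThan_4 G.twin_dist_def H.twin_dist_def dist_P4_def dist_Paw_def)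

lemma diam_G: "diam (blow_up P4 [1, 16, 8, 36]) = 3"
  \<comment> \<open>The ends of the path realise the distance 3.\<close>
  by (rule G.diam_eqI[where i = 0 and j = 3])
    (auto simp: pverts_P4 lessThan_4 G.twin_dist_def dist_P4_def)

lemma diam_H: "diam (blow_up Paw [4, 9, 16, 32]) = 2"
  \<comment> \<open>The pendant vertex 3 and the triangle vertex 1 are at distance 2, through
    0.\<close>
  by (rule H.diam_eqI[where i = 1 and j = 3])
    (auto simp: pverts_Paw H.twin_dist_def dist_Paw_def)

text \<open>Modulo 2 the distance on the path is the parity of \<open>i + j\<close>, so columns of
  equal parity coincide and \<open>{0, 1}\<close> represents them.\<close>

lemma rank_G: "distance_rank_mod2 (blow_up P4 [1, 16, 8, 36]) = 2"
proof -
  have "distance_rank_mod2 (blow_up P4 [1, 16, 8, 36]) = card {0, 1 :: nat}"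
  proof (rule G.distance_rank_mod2)
    fix f :: "nat \<Rightarrow> bit"
    assume *: "\<And>a. a \<in> pverts P4 \<Longrightarrow> (\<Sum>b\<in>{0, 1}. f b * of_nat (G.twin_dist a b)) = 0"
    have sum: "(\<Sum>b\<in>{0, 1}. g b) = g 0 + g 1" for g :: "nat \<Rightarrow> bit"
      by simp
    \<comment> \<open>Row 0 gives \<open>f 1 = 0\<close> and row 1 gives
      \<open>f 0 = 0\<close>.\<close>
    show "\<forall>b\<in>{0, 1}. f b = 0"
      using *[of 0, unfolded sum] *[of 1, unfolded sum] by (simp add: pverts_P4 G.twin_dist_def dist_P4_def)
  qed (auto simp: pverts_P4 lessThan_4 G.twin_dist_def dist_P4_def)
  then show ?thesis by simp
qed

text \<open>Distances 2 vanish modulo 2, leaving the adjacency matrix of \<open>Paw\<close>, whose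
  four columns are independent.\<close>

lemma rank_H: "distance_rank_mod2 (blow_up Paw [4, 9, 16, 32]) = 4"
proof -
  have "distance_rank_mod2 (blow_up Paw [4, 9, 16, 32]) = card {..<4 :: nat}"
  proof (rule H.distance_rank_mod2)
    fix f :: "nat \<Rightarrow> bit"
    assume *: "\<And>a. a \<in> pverts Paw \<Longrightarrow> (\<Sum>b\<in>{..<4}. f b * of_nat (H.twin_dist a b)) = 0"
    \<comment> \<open>Row 3 gives \<open>f 0 = 0\<close>; rows 1, 2 and 0 then give
      \<open>f 2 = 0\<close>, \<open>f 1 = 0\<close> and \<open>f 3 = 0\<close> in turn.\<close>
    show "\<forall>b\<in>{..<4}. f b = 0"
      using *[of 0, unfolded sum_lessThan_4] *[of 1, unfolded sum_lessThan_4]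
        *[of 2, unfolded sum_lessThan_4] *[of 3, unfolded sum_lessThan_4]
      by (simp add: pverts_Paw H.twin_dist_def dist_Paw_def lessThan_4)
  qed (auto simp: pverts_Paw)
  then show ?thesis by simp
qed

lemma spectrum:
  "distance_spectrum (blow_up P4 [1, 16, 8, 36]) = distance_spectrum (blow_up Paw [4, 9, 16, 32])"
proof -
  have "det (mat 4 4 (\<lambda>(a, b). (if a = b then [:2, 1:] else 0)
          - [:real (G.twin_dist a b) * real ([1, 16, 8, 36] ! b):])) =
    det (mat 4 4 (\<lambda>(a, b). (if a = b then [:2, 1:] else 0)
          - [:real (H.twin_dist a b) * real ([4, 9, 16, 32] ! b):]))"
    \<comment> \<open>Both determinants are expanded along first rows down to size 1; numerals
      become \<open>Suc\<close> terms so that the dimensions match the expansion rules.\<close>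
    by (simp add: laplace_expansion_row[of _ "Suc (Suc (Suc (Suc 0)))" 0]
        laplace_expansion_row[of _ "Suc (Suc (Suc 0))" 0] laplace_expansion_row[of _ "Suc (Suc 0)" 0]
        det_single cofactor_def mat_delete_def numeral_eq_Suc
        G.twin_dist_def H.twin_dist_def dist_P4_def dist_Paw_def)
  \<comment> \<open>Both graphs have 61 vertices, so the powers of \<open>[:2, 1:]\<close> on the
    right agree.\<close>
  moreover have "(\<Sum>i<4. [1, 16, 8, 36] ! i) = (\<Sum>i<4. [4, 9, 16, 32] ! i :: nat)"
    by (simp add: lessThan_4)
  ultimately have "[:2, 1:] ^ 4 * char_poly (map_mat real (distance_matrix (blow_up P4 [1, 16, 8, 36]))) =
      [:2, 1:] ^ 4 * char_poly (map_mat real (distance_matrix (blow_up Paw [4, 9, 16, 32])))"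
    using G.char_poly_distance_matrix[OF pverts_P4] H.char_poly_distance_matrix[OF pverts_Paw]
    unfolding pverts_P4 pverts_Paw by simp
  \<comment> \<open>The nonzero factor \<open>[:2, 1:] ^ 4\<close> cancels, leaving equal
    characteristic polynomials.\<close>
  then show ?thesis by (simp add: distance_spectrum_def)
qed

theorem corollary3p2:
  fixes G H :: "(nat \<times> nat) pair_pre_digraph"
  assumes "G = blow_up P4 [1, 16, 8, 36]"
    and "H = blow_up Paw [4, 9, 16, 32]"
  shows "(card (edges G) \<noteq> card (edges H) \<and> diam G \<noteq> diam H \<and>
          wiener_index G \<noteq> wiener_index H \<and> distance_rank_mod2 G \<noteq> distance_rank_mod2 H) \<and>
         (card (edges G) = 432 \<and> diam G = 3 \<and> wiener_index G = 3264 \<and> distance_rank_mod2 G = 2) \<and>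
         (card (edges H) = 372 \<and> diam H = 2 \<and> wiener_index H = 3288 \<and> distance_rank_mod2 H = 4) \<and>
         (connected_graph G \<and> connected_graph H \<and> distance_spectrum G = distance_spectrum H) \<and>
         (\<exists>(X :: (nat \<times> nat) pair_pre_digraph) (Y :: (nat \<times> nat) pair_pre_digraph).
            connected_graph X \<and> connected_graph Y \<and>
            distance_spectrum X = distance_spectrum Y \<and>
            distance_rank_mod2 X \<noteq> distance_rank_mod2 Y)"
proof -
  have edges: "card (edges G) = 432" "card (edges H) = 372"
    unfolding assms by (rule card_edges)+
  have diam: "diam G = 3" "diam H = 2"
    unfolding assms by (rule diam_G diam_H)+
  have wiener: "wiener_index G = 3264" "wiener_index H = 3288"
    unfolding assms by (rule wiener_indices)+
  have rank: "distance_rank_mod2 G = 2" "distance_rank_mod2 H = 4"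
    unfolding assms by (rule rank_G rank_H)+
  have cospectral: "connected_graph G" "connected_graph H"
    "distance_spectrum G = distance_spectrum H"
    unfolding assms by (rule G.connected_graph H.connected_graph spectrum)+
  have "distance_rank_mod2 G \<noteq> distance_rank_mod2 H" using rank by simp
  with cospectral have "\<exists>(X :: (nat \<times> nat) pair_pre_digraph) (Y :: (nat \<times> nat) pair_pre_digraph).
      connected_graph X \<and> connected_graph Y \<and> distance_spectrum X = distance_spectrum Y \<and>
      distance_rank_mod2 X \<noteq> distance_rank_mod2 Y"
    by blast
  with edges diam wiener rank cospectral show ?thesis by simp
qed

end
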